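(* Let $A\times X\to Y$, $(a,x)\mapsto ax$, be a Banach action such that $A$ is a Hilbert space possessing an orthonormal basis $(e_n)_{n\in\omega}$ such that for every $x\in X$ the series $\sum_{n\in\omega}e_nx$ is unconditionally convergent in $Y$. Then the Banach action $A\times X\to Y$ preserves unconditional convergence.
   Context: All Banach spaces are over the field $\mathbb F$ of real or complex numbers, and $\omega=\{0,1,2,\dots\}$. A Banach action is a continuous bilinear function $A\times X\to Y$, $(a,x)\mapsto ax$, where $A,X,Y$ are Banach spaces (over the same field $\mathbb F$). A series $\sum_{n\in\omega}x_n$ in a Banach space $X$ converges unconditionally if for every permutation $\sigma$ of $\omega$ the series $\sum_{n\in\omega}x_{\sigma(n)}$ converges in $X$. A Banach action $A\times X\to Y$ preserves unconditional convergence if for every unconditionally convergent series $\sum_{n\in\omega}x_n$ in $X$ and every bounded sequence $(a_n)_{n\in\omega}$ in $A$ the series $\sum_{n\in\omega}a_nx_n$ converges unconditionally in $Y$. *)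

theory Defs
  imports "HOL-Analysis.Analysis"
begin

text \<open>
  The library's normed spaces are real. A complex normed space is presented as a real normed
  space with a complex scalar multiplication that extends the real one; completeness is then
  the library class \<^class>\<open>banach\<close>.
\<close>

class complex_vector = real_vector +
  fixes scaleC :: "complex \<Rightarrow> 'a \<Rightarrow> 'a"  (infixr "*\<^sub>C" 75)
  assumes scaleC_add_right: "c *\<^sub>C (x + y) = c *\<^sub>C x + c *\<^sub>C y"
    and scaleC_add_left: "(c + d) *\<^sub>C x = c *\<^sub>C x + d *\<^sub>C x"
    and scaleC_scaleC: "c *\<^sub>C d *\<^sub>C x = (c * d) *\<^sub>C x"
    and scaleC_of_real: "complex_of_real r *\<^sub>C x = r *\<^sub>R x"

class complex_normed_vector = complex_vector + real_normed_vector +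
  assumes norm_scaleC: "norm (c *\<^sub>C x) = cmod c * norm x"

text \<open>
  The inner product is linear in the first argument. Positive definiteness is part of
  \<open>cinner_self\<close>, which also says that the norm is the one induced by the inner product.
\<close>

class complex_inner = complex_normed_vector +
  fixes cinner :: "'a \<Rightarrow> 'a \<Rightarrow> complex"
  assumes cinner_commute: "cinner x y = cnj (cinner y x)"
    and cinner_add_left: "cinner (x + y) z = cinner x z + cinner y z"
    and cinner_scaleC_left: "cinner (c *\<^sub>C x) y = c * cinner x y"
    and cinner_self: "cinner x x = complex_of_real ((norm x)\<^sup>2)"

lemma vector_space_scaleC:
  "vector_space (scaleC :: complex \<Rightarrow> 'a \<Rightarrow> 'a::complex_vector)"
proof
  fix x :: 'a
  show "1 *\<^sub>C x = x"
    using scaleC_of_real[of 1 x] by simp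
qed (simp_all add: scaleC_add_right scaleC_add_left scaleC_scaleC)

instantiation complex :: complex_inner
begin
definition scaleC_complex :: "complex \<Rightarrow> complex \<Rightarrow> complex"
  where "scaleC_complex c x = c * x"
definition cinner_complex :: "complex \<Rightarrow> complex \<Rightarrow> complex"
  where "cinner_complex x y = x * cnj y"
instance
  by standard
    (simp_all add: scaleC_complex_def cinner_complex_def algebra_simps norm_mult
      scaleR_conv_of_real complex_norm_square flip: complex_norm_square)
end

text \<open>
  The following two notions take the scalar multiplications (and the inner product) as
  parameters, so that they can be used over both fields.
\<close>

definition banach_action ::
  "('k::field \<Rightarrow> 'a \<Rightarrow> 'a) \<Rightarrow> ('k \<Rightarrow> 'x \<Rightarrow> 'x) \<Rightarrow> ('k \<Rightarrow> 'y \<Rightarrow> 'y) \<Rightarrow>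
    ('a::banach \<Rightarrow> 'x::banach \<Rightarrow> 'y::banach) \<Rightarrow> bool" where
  "banach_action sA sX sY act \<longleftrightarrow>
    (\<forall>x. Vector_Spaces.linear sA sY (\<lambda>a. act a x)) \<and>
    (\<forall>a. Vector_Spaces.linear sX sY (\<lambda>x. act a x)) \<and>
    continuous_on UNIV (\<lambda>(a, x). act a x)"

definition orthonormal_basis ::
  "('k::field \<Rightarrow> 'a \<Rightarrow> 'a) \<Rightarrow> ('a::real_normed_vector \<Rightarrow> 'a \<Rightarrow> 'k) \<Rightarrow> (nat \<Rightarrow> 'a) \<Rightarrow> bool" where
  "orthonormal_basis s ip e \<longleftrightarrow>
    (\<forall>m n. ip (e m) (e n) = (if m = n then 1 else 0)) \<and>
    closure (module.span s (range e)) = UNIV"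

definition unconditionally_convergent :: "(nat \<Rightarrow> 'a::real_normed_vector) \<Rightarrow> bool" where
  "unconditionally_convergent x \<longleftrightarrow> (\<forall>\<sigma>. bij \<sigma> \<longrightarrow> summable (\<lambda>n. x (\<sigma> n)))"

definition preserves_unconditional_convergence ::
  "('a::real_normed_vector \<Rightarrow> 'x::real_normed_vector \<Rightarrow> 'y::real_normed_vector) \<Rightarrow> bool" where
  "preserves_unconditional_convergence act \<longleftrightarrow>
    (\<forall>x a. unconditionally_convergent x \<and> bounded (range a) \<longrightarrow>
      unconditionally_convergent (\<lambda>n. act (a n) (x n)))"

end

theory Submission
  imports Defs
begin

text \<open>
  Let $\sum_k x_k$ be unconditionally convergent, and let the vectors $a_k = \sum_n c_{kn} e_n$
  be finite combinations with $\sum_n c_{kn}^2 \le R^2$. The point is to separate the two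
  indices $k$ and $n$ in $\sum_k a_k x_k = \sum_{k,n} c_{kn}\, e_n x_k$. Let
  $\varepsilon = (\varepsilon_n)$ be independent random signs. If every row of the matrix is
  written as $c_{kn} = \mathbf{E}\,\varepsilon_n f_k(\varepsilon)$ with $|f_k| \le 2R$, then
  bilinearity gives
  \[ \sum_k a_k x_k = \mathbf{E} \Bigl(\sum_n \varepsilon_n e_n\Bigr)
     \Bigl(\sum_k f_k(\varepsilon) x_k\Bigr) . \]
  The vectors $\sum_n \varepsilon_n e_n$ act on $X$ with norms bounded independently of the signs
  and of the number of terms, by the uniform boundedness principle, since the series
  $\sum_n e_n z$ are all unconditionally convergent. The second factor is small as soon as $k$
  ranges over a finite set of large indices, since the $f_k(\varepsilon)$ are bounded scalars.
  So $\sum_k a_k x_k$ is small over such a set of $k$, uniformly in the choice of the $a_k$.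
  
  The functions $f_k$ are imaginary parts of Riesz products: for real $b_n$ with
  $\sum_n b_n^2 \le 1$ the function $f(\varepsilon) = \mathrm{Im} \prod_n (1 + i b_n \varepsilon_n)$
  satisfies $\mathbf{E}\,\varepsilon_n f = b_n$ and
  $|f|^2 \le \prod_n (1 + b_n^2) \le \exp \sum_n b_n^2 \le e < 4$
  (\<open>ex_bounded_function_with_rademacher_coefficients\<close>). This is an explicit dual form of the
  Khinchine inequality between $L^1$ and $L^2$, and the argument is the corresponding form of
  Littlewood's mixed-norm inequality.
  
  For vectors $a_k$ in the span of the basis, orthonormality gives
  $\sum_n |c_{kn}|^2 = \|a_k\|^2$, so the estimate is uniform over bounded sequences in the span;
  density of the span extends it to all bounded sequences. Over
  the complex numbers the estimate is applied twice, to the real parts of the coefficients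
  with the vectors $e_n$ and to their imaginary parts with the vectors $i e_n$.
\<close>

section \<open>Unconditional convergence and finite sums far out\<close>

text \<open>
  The Cauchy criterion for the net of finite partial sums. In a Banach space it is equivalent to
  convergence under all permutations, and it is the form in which unconditional convergence can
  be estimated.
\<close>

definition small_tails :: "(nat \<Rightarrow> 'a::real_normed_vector) \<Rightarrow> bool" where
  "small_tails x \<longleftrightarrow> (\<forall>\<epsilon>>0. \<exists>N. \<forall>F. finite F \<and> F \<subseteq> {N..} \<longrightarrow> norm (sum x F) \<le> \<epsilon>)"

lemma small_tailsD:
  assumes "small_tails x" "0 < \<epsilon>"
  obtains N where "\<And>F. finite F \<Longrightarrow> F \<subseteq> {N..} \<Longrightarrow> norm (sum x F) \<le> \<epsilon>"
  using assms unfolding small_tails_def by metis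

lemma small_tails_imp_unconditionally_convergent:
  fixes x :: "nat \<Rightarrow> 'a::banach"
  assumes "small_tails x"
  shows "unconditionally_convergent x"
  unfolding unconditionally_convergent_def summable_Cauchy
proof (intro allI impI)
  fix \<sigma> :: "nat \<Rightarrow> nat" and \<epsilon> :: real
  assume \<sigma>: "bij \<sigma>" and "0 < \<epsilon>"
  then have "0 < \<epsilon> / 2" by simp
  with assms obtain N where N: "\<And>F. finite F \<Longrightarrow> F \<subseteq> {N..} \<Longrightarrow> norm (sum x F) \<le> \<epsilon> / 2"
    using small_tailsD by blast
  have inj: "inj \<sigma>" using \<sigma> bij_is_inj by blast
  have "finite (\<sigma> -` {..<N})"
    using inj by (intro finite_vimageI) auto
  then obtain M where M: "\<sigma> -` {..<N} \<subseteq> {..<M}"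
    using finite_nat_iff_bounded by blast
  have "norm (\<Sum>n\<in>{m..<n}. x (\<sigma> n)) < \<epsilon>" if "M \<le> m" for m n
  proof -
    have "\<sigma> ` {m..<n} \<subseteq> {N..}"
      using M that by (force simp: not_less[symmetric])
    then have "norm (sum x (\<sigma> ` {m..<n})) \<le> \<epsilon> / 2"
      by (intro N) auto
    also have "sum x (\<sigma> ` {m..<n}) = (\<Sum>n\<in>{m..<n}. x (\<sigma> n))"
      using inj by (subst sum.reindex) (auto intro: inj_on_subset)
    finally show ?thesis using \<open>0 < \<epsilon>\<close> by simp
  qed
  then show "\<exists>M. \<forall>m\<ge>M. \<forall>n. norm (\<Sum>n\<in>{m..<n}. x (\<sigma> n)) < \<epsilon>"
    by blast
qed

text \<open>
  The next two lemmas build a permutation that makes given finite sets into blocks of consecutive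
  terms of the rearranged series: within one interval the elements of the set are moved to the
  front, and such permutations of consecutive intervals are then glued together.
\<close>

lemma ex_permutation_of_interval_enumerating_subset:
  fixes a b :: nat
  assumes "F \<subseteq> {a..<b}"
  shows "\<exists>p. bij_betw p {a..<b} {a..<b} \<and> p ` {a..<a + card F} = F"
proof -
  have fin: "finite F" using assms finite_subset by blast
  have le: "a + card F \<le> b \<or> F = {}"
    using card_mono[OF _ assms] assms by (cases "a \<le> b") auto
  obtain p where p: "bij_betw p {a..<a + card F} F"
    using fin finite_same_card_bij[of "{a..<a + card F}" F] by auto
  have sub: "{a..<a + card F} \<subseteq> {a..<b}" using le by auto
  have "card ({a..<b} - {a..<a + card F}) = card ({a..<b} - F)"
    using sub assms fin by (simp add: card_Diff_subset)
  then obtain q where q: "bij_betw q ({a..<b} - {a..<a + card F}) ({a..<b} - F)"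
    using finite_same_card_bij[of "{a..<b} - {a..<a + card F}" "{a..<b} - F"] by auto
  let ?r = "\<lambda>n. if n \<in> {a..<a + card F} then p n else q n"
  have "bij_betw ?r ({a..<a + card F} \<union> ({a..<b} - {a..<a + card F})) (F \<union> ({a..<b} - F))"
    using p q by (rule bij_betw_disjoint_Un) auto
  moreover have "{a..<a + card F} \<union> ({a..<b} - {a..<a + card F}) = {a..<b}"
    using sub by blast
  moreover have "F \<union> ({a..<b} - F) = {a..<b}"
    using assms by blast
  ultimately have "bij_betw ?r {a..<b} {a..<b}" by simp
  moreover have "?r ` {a..<a + card F} = F"
  proof -
    have "?r ` {a..<a + card F} = p ` {a..<a + card F}" by (intro image_cong) auto
    then show ?thesis using bij_betw_imp_surj_on[OF p] by simp
  qed
  ultimately show ?thesis by blast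
qed

lemma bij_of_block_permutations:
  fixes N :: "nat \<Rightarrow> nat"
  assumes N: "strict_mono N" "N 0 = 0"
    and p: "\<And>j. bij_betw (p j) {N j..<N (Suc j)} {N j..<N (Suc j)}"
  shows "\<exists>\<sigma>. bij \<sigma> \<and> (\<forall>j. \<forall>n\<in>{N j..<N (Suc j)}. \<sigma> n = p j n)"
proof -
  \<comment> \<open>\<open>J n\<close> is the number of the block that contains \<open>n\<close>.\<close>
  define J where "J n = (LEAST j. n < N (Suc j))" for n
  have J_eq: "J n = j" if "n \<in> {N j..<N (Suc j)}" for n j
    unfolding J_def
  proof (rule Least_equality)
    show "n < N (Suc j)" using that by auto
    fix i assume "n < N (Suc i)"
    with that have "N j < N (Suc i)" by simp
    then show "j \<le> i" using N(1) by (simp add: strict_mono_less)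
  qed
  have J_mem: "n \<in> {N (J n)..<N (Suc (J n))}" for n
  proof -
    have "n \<le> N n" using N(1) by (rule strict_mono_imp_increasing)
    also have "N n < N (Suc n)" using N(1) by (simp add: strict_mono_less)
    finally have ex: "\<exists>j. n < N (Suc j)" by blast
    have "N (J n) \<le> n"
    proof (cases "J n")
      case (Suc j)
      then have "\<not> n < N (Suc j)" unfolding J_def by (metis lessI not_less_Least)
      then show ?thesis using Suc by simp
    qed (simp add: N)
    then show ?thesis using LeastI_ex[OF ex] by (simp add: J_def)
  qed
  define \<sigma> where "\<sigma> n = p (J n) n" for n
  have J_\<sigma>: "J (\<sigma> n) = J n" for n
    unfolding \<sigma>_def using p J_mem by (intro J_eq) (meson bij_betwE)
  have "inj \<sigma>"
  proof (rule injI)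
    fix m n assume eq: "\<sigma> m = \<sigma> n"
    then have "J m = J n" using J_\<sigma> by metis
    then show "m = n"
      using eq p[of "J n"] J_mem[of m] J_mem[of n] unfolding \<sigma>_def bij_betw_def
      by (auto dest: inj_onD)
  qed
  moreover have "surj \<sigma>"
    unfolding surj_def
  proof
    fix y
    obtain n where "n \<in> {N (J y)..<N (Suc (J y))}" "y = p (J y) n"
      using p[of "J y"] J_mem[of y] unfolding bij_betw_def by blast
    then have "\<sigma> n = y" using J_eq unfolding \<sigma>_def by metis
    then show "\<exists>n. y = \<sigma> n" by metis
  qed
  ultimately have "bij \<sigma>" by (simp add: bij_def)
  moreover have "\<sigma> n = p j n" if "n \<in> {N j..<N (Suc j)}" for j n
    using J_eq[OF that] by (simp add: \<sigma>_def)
  ultimately show ?thesis by blast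
qed

text \<open>
  If the criterion fails, there are finite sets arbitrarily far out over which the sum exceeds
  some fixed $\varepsilon$. A permutation that lists infinitely many of them, each as a block of
  consecutive terms, produces a rearranged series that is not Cauchy.
\<close>

lemma unconditionally_convergent_imp_small_tails:
  fixes x :: "nat \<Rightarrow> 'a::banach"
  assumes "unconditionally_convergent x"
  shows "small_tails x"
proof (rule ccontr)
  assume "\<not> small_tails x"
  then obtain \<epsilon> where \<epsilon>: "0 < \<epsilon>"
    and "\<forall>N. \<exists>F. (finite F \<and> F \<subseteq> {N..}) \<and> \<epsilon> < norm (sum x F)"
    unfolding small_tails_def not_all not_ex not_imp not_le by iprover
  then obtain F where F: "\<And>N. finite (F N)" "\<And>N. F N \<subseteq> {N..}" "\<And>N. \<epsilon> < norm (sum x (F N))"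
    by metis
  have "\<exists>b>N. F N \<subseteq> {N..<b}" for N
  proof -
    obtain b where "F N \<subseteq> {..<b}" using F(1) finite_nat_iff_bounded by blast
    then have "F N \<subseteq> {N..<max b (Suc N)}" using F(2)[of N] by force
    moreover have "N < max b (Suc N)" by simp
    ultimately show ?thesis by blast
  qed
  then obtain b where b: "\<And>N. N < b N" "\<And>N. F N \<subseteq> {N..<b N}"
    by metis
  \<comment> \<open>The intervals from \<open>N j\<close> to \<open>N (Suc j)\<close> partition the naturals, and each contains a bad set.\<close>
  define N where "N j = (b ^^ j) 0" for j
  have N_Suc: "N (Suc j) = b (N j)" for j by (simp add: N_def)
  have N: "strict_mono N" "N 0 = 0"
    using b(1) by (auto simp: strict_mono_Suc_iff N_Suc) (simp add: N_def)
  have "\<forall>j. \<exists>p. bij_betw p {N j..<N (Suc j)} {N j..<N (Suc j)} \<and>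
      p ` {N j..<N j + card (F (N j))} = F (N j)"
    unfolding N_Suc using ex_permutation_of_interval_enumerating_subset[OF b(2)] by blast
  then obtain p where p: "\<And>j. bij_betw (p j) {N j..<N (Suc j)} {N j..<N (Suc j)}"
    "\<And>j. p j ` {N j..<N j + card (F (N j))} = F (N j)"
    by metis
  obtain \<sigma> where \<sigma>: "bij \<sigma>" "\<And>j n. n \<in> {N j..<N (Suc j)} \<Longrightarrow> \<sigma> n = p j n"
    using bij_of_block_permutations[OF N p(1)] by metis
  have "summable (\<lambda>n. x (\<sigma> n))"
    using assms \<sigma>(1) by (simp add: unconditionally_convergent_def)
  then obtain M where M: "\<And>m n. M \<le> m \<Longrightarrow> norm (\<Sum>n\<in>{m..<n}. x (\<sigma> n)) < \<epsilon>"
    unfolding summable_Cauchy using \<epsilon> by metis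
  let ?I = "{N M..<N M + card (F (N M))}"
  have "card (F (N M)) \<le> N (Suc M) - N M"
    using card_mono[OF _ b(2)[of "N M"]] by (simp add: N_Suc)
  then have "?I \<subseteq> {N M..<N (Suc M)}" by auto
  then have "\<sigma> ` ?I = p M ` ?I" using \<sigma>(2) by (intro image_cong) auto
  then have F_eq: "\<sigma> ` ?I = F (N M)" using p(2) by (rule trans)
  have "(\<Sum>n\<in>?I. x (\<sigma> n)) = sum x (\<sigma> ` ?I)"
    using inj_on_subset[OF bij_is_inj[OF \<sigma>(1)] subset_UNIV] by (simp add: sum.reindex)
  also have "\<dots> = sum x (F (N M))" unfolding F_eq by (rule refl)
  finally have "norm (\<Sum>n\<in>?I. x (\<sigma> n)) = norm (sum x (F (N M)))" by (rule arg_cong)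
  moreover have "M \<le> N M" using N(1) by (rule strict_mono_imp_increasing)
  ultimately show False using M[of "N M" "N M + card (F (N M))"] F(3)[of "N M"] by linarith
qed

lemma small_tails_iff_unconditionally_convergent:
  fixes x :: "nat \<Rightarrow> 'a::banach"
  shows "small_tails x \<longleftrightarrow> unconditionally_convergent x"
  using small_tails_imp_unconditionally_convergent unconditionally_convergent_imp_small_tails by blast

text \<open>
  The norm is convex, so on the cube of coefficients $0 \le s_k \le 1$ it is bounded by its values
  at the vertices, which are the subset sums. The shift \<open>v\<close> makes the induction over the
  coordinates work.
\<close>

lemma norm_sum_scaleR_le_of_subset_sums:
  fixes x :: "'i \<Rightarrow> 'a::real_normed_vector"
  assumes "finite F" "\<And>H. H \<subseteq> F \<Longrightarrow> norm (v + sum x H) \<le> \<epsilon>"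
    "\<And>k. k \<in> F \<Longrightarrow> 0 \<le> s k" "\<And>k. k \<in> F \<Longrightarrow> s k \<le> 1"
  shows "norm (v + (\<Sum>k\<in>F. s k *\<^sub>R x k)) \<le> \<epsilon>"
  using assms
proof (induction F arbitrary: v rule: finite_induct)
  case empty
  then show ?case using empty(1)[of "{}"] by simp
next
  case (insert k F)
  let ?w = "\<Sum>k\<in>F. s k *\<^sub>R x k"
  have 1: "norm (v + ?w) \<le> \<epsilon>"
    using insert.prems by (intro insert.IH) (auto simp: subset_insertI2)
  have 2: "norm ((v + x k) + ?w) \<le> \<epsilon>"
  proof (rule insert.IH)
    fix H assume H: "H \<subseteq> F"
    then have "finite H" "k \<notin> H" using insert.hyps finite_subset by auto
    then have "(v + x k) + sum x H = v + sum x (insert k H)" by (simp add: add.assoc)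
    moreover have "insert k H \<subseteq> insert k F" using H by blast
    ultimately show "norm ((v + x k) + sum x H) \<le> \<epsilon>"
      using insert.prems(1) by metis
  qed (use insert.prems in auto)
  have "v + (\<Sum>k\<in>insert k F. s k *\<^sub>R x k) = (1 - s k) *\<^sub>R (v + ?w) + s k *\<^sub>R ((v + x k) + ?w)"
    using insert.hyps by (simp add: algebra_simps)
  also have "norm \<dots> \<le> (1 - s k) * norm (v + ?w) + s k * norm ((v + x k) + ?w)"
    using insert.prems(2,3)[of k] norm_triangle_ineq[of "(1 - s k) *\<^sub>R (v + ?w)" "s k *\<^sub>R ((v + x k) + ?w)"]
    by simp
  also have "\<dots> \<le> (1 - s k) * \<epsilon> + s k * \<epsilon>"
    using 1 2 insert.prems(2,3)[of k] by (intro add_mono mult_left_mono) auto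
  finally show ?case by (simp add: algebra_simps)
qed

text \<open>
  Split $s_k / C$ into its positive and negative parts, both with values in $[0, 1]$.
\<close>

lemma norm_sum_scaleR_le:
  fixes x :: "'i \<Rightarrow> 'a::real_normed_vector"
  assumes "finite F" and H: "\<And>H. H \<subseteq> F \<Longrightarrow> norm (sum x H) \<le> \<epsilon>"
    and C: "0 < C" "\<And>k. k \<in> F \<Longrightarrow> \<bar>s k\<bar> \<le> C"
  shows "norm (\<Sum>k\<in>F. s k *\<^sub>R x k) \<le> 2 * C * \<epsilon>"
proof -
  have part: "norm (\<Sum>k\<in>F. t k *\<^sub>R x k) \<le> \<epsilon>" if "\<And>k. k \<in> F \<Longrightarrow> 0 \<le> t k \<and> t k \<le> 1" for t
    using norm_sum_scaleR_le_of_subset_sums[of F 0 x \<epsilon> t] assms(1) H that by simp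
  let ?p = "\<lambda>k. max (s k) 0 / C" and ?n = "\<lambda>k. max (- s k) 0 / C"
  have "C * (?p k - ?n k) = s k" for k
    using C(1) by (auto simp: max_def field_simps)
  then have "(\<Sum>k\<in>F. s k *\<^sub>R x k) = C *\<^sub>R ((\<Sum>k\<in>F. ?p k *\<^sub>R x k) - (\<Sum>k\<in>F. ?n k *\<^sub>R x k))"
    by (simp add: scaleR_sum_right sum_subtractf[symmetric] scaleR_left_diff_distrib[symmetric])
  also have "norm \<dots> \<le> C * (norm (\<Sum>k\<in>F. ?p k *\<^sub>R x k) + norm (\<Sum>k\<in>F. ?n k *\<^sub>R x k))"
    using C(1) norm_triangle_ineq4 by simp
  also have "\<dots> \<le> C * (\<epsilon> + \<epsilon>)"
  proof -
    have "norm (\<Sum>k\<in>F. ?p k *\<^sub>R x k) \<le> \<epsilon>" "norm (\<Sum>k\<in>F. ?n k *\<^sub>R x k) \<le> \<epsilon>"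
      using C by (auto intro!: part simp: max_def abs_le_iff)
    then show ?thesis using C(1) by (intro mult_left_mono add_mono) auto
  qed
  finally show ?thesis by simp
qed

lemma small_tails_bounded_sums:
  fixes x :: "nat \<Rightarrow> 'a::real_normed_vector"
  assumes "small_tails x"
  shows "\<exists>C. \<forall>F. finite F \<longrightarrow> norm (sum x F) \<le> C"
proof -
  obtain N where N: "\<And>F. finite F \<Longrightarrow> F \<subseteq> {N..} \<Longrightarrow> norm (sum x F) \<le> 1"
    using small_tailsD[OF assms zero_less_one] by blast
  have "norm (sum x F) \<le> (\<Sum>n<N. norm (x n)) + 1" if "finite F" for F
  proof -
    have "sum x F = sum x (F \<inter> {..<N}) + sum x (F - {..<N})"
      using that by (simp add: sum.Int_Diff)
    then have "norm (sum x F) \<le> norm (sum x (F \<inter> {..<N})) + norm (sum x (F - {..<N}))"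
      using norm_triangle_ineq by metis
    also have "norm (sum x (F \<inter> {..<N})) \<le> (\<Sum>n\<in>F \<inter> {..<N}. norm (x n))"
      by (rule norm_sum)
    also have "\<dots> \<le> (\<Sum>n<N. norm (x n))"
      by (intro sum_mono2) auto
    also have "norm (sum x (F - {..<N})) \<le> 1"
      using that by (intro N) auto
    finally show ?thesis by simp
  qed
  then show ?thesis by blast
qed

section \<open>The uniform boundedness principle\<close>

text \<open>
  The usual Baire category argument: the sets of points at which all operators are bounded
  by \<open>m\<close> are closed and cover the space, so one of them contains a ball.
\<close>

lemma uniform_boundedness:
  fixes T :: "'i \<Rightarrow> 'x::banach \<Rightarrow> 'y::real_normed_vector"
  assumes T: "\<And>i. bounded_linear (T i)" and bd: "\<And>x. \<exists>C. \<forall>i. norm (T i x) \<le> C"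
  obtains C where "0 < C" "\<And>i x. norm (T i x) \<le> C * norm x"
proof -
  define E where "E m = {x. \<forall>i. norm (T i x) \<le> real m}" for m
  have closed_E: "closed (E m)" for m
  proof -
    have "E m = (\<Inter>i. {x. norm (T i x) \<le> real m})" by (auto simp: E_def)
    moreover have "closed {x. norm (T i x) \<le> real m}" for i
      by (intro closed_Collect_le continuous_intros bounded_linear.continuous_on[OF T])
    ultimately show ?thesis by auto
  qed
  have "x \<in> (\<Union>m. E m)" for x
  proof -
    obtain C where "\<forall>i. norm (T i x) \<le> C" using bd by blast
    moreover obtain m where "C \<le> real m" using real_arch_simple by blast
    ultimately have "x \<in> E m" by (auto simp: E_def intro: order_trans)
    then show ?thesis by blast
  qed
  then have "(\<Union>m. E m) = UNIV" by blast
  then have "euclidean interior_of (\<Union>(range E)) \<noteq> {}" by simp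
  have "\<exists>m. interior (E m) \<noteq> {}"
  proof (rule ccontr)
    assume "\<not> ?thesis"
    then have "closedin euclidean A \<and> euclidean interior_of A = {}" if "A \<in> range E" for A
      using that closed_E by auto
    then have "euclidean interior_of (\<Union>(range E)) = {}"
      by (intro Baire_category_alt) (auto simp: completely_metrizable_space_euclidean)
    then show False using \<open>euclidean interior_of (\<Union>(range E)) \<noteq> {}\<close> by contradiction
  qed
  then obtain m where "interior (E m) \<noteq> {}" by blast
  then obtain z r where r: "0 < r" "ball z r \<subseteq> E m"
    by (meson ex_in_conv mem_interior)
  have small: "norm (T i h) \<le> 2 * real m" if "norm h < r" for i h
  proof -
    have "z \<in> E m" "z + h \<in> E m" using r that by (auto simp: subset_iff dist_norm)
    then have "norm (T i (z + h)) \<le> real m" "norm (T i z) \<le> real m"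
      by (auto simp: E_def)
    moreover have "T i h = T i (z + h) - T i z"
      using linear_diff[OF bounded_linear.linear[OF T[of i]], of "z + h" z] by simp
    ultimately show ?thesis using norm_triangle_ineq4[of "T i (z + h)" "T i z"] by simp
  qed
  have "norm (T i x) \<le> (4 * real m / r + 1) * norm x" for i x
  proof (cases "x = 0")
    case True
    then show ?thesis using linear_0[OF bounded_linear.linear[OF T[of i]]] by simp
  next
    case False
    let ?t = "r / (2 * norm x)"
    have t: "0 < ?t" using False r by simp
    have "norm (T i (?t *\<^sub>R x)) \<le> 2 * real m"
      using False r by (intro small) simp
    also have "T i (?t *\<^sub>R x) = ?t *\<^sub>R T i x"
      using linear_scale[OF bounded_linear.linear[OF T[of i]]] by blast
    finally have "?t * norm (T i x) \<le> 2 * real m" using r(1) by simp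
    then have "norm (T i x) \<le> 4 * real m / r * norm x"
      using False r by (simp add: field_simps)
    then show ?thesis by (simp add: distrib_right add_increasing2)
  qed
  moreover have "0 < 4 * real m / r + 1" using r by (simp add: add_nonneg_pos)
  ultimately show thesis using that by blast
qed

section \<open>Rademacher coefficients of bounded functions\<close>

text \<open>
  A sign pattern is given by the set \<open>S\<close> of the positions with sign $+1$, so that averaging over
  random signs on a finite index set \<open>G\<close> is averaging over \<open>Pow G\<close>.
\<close>

definition rademacher :: "'i set \<Rightarrow> 'i \<Rightarrow> real" where
  "rademacher S n = (if n \<in> S then 1 else - 1)"

text \<open>
  The expectation of a product of functions of independent signs is the product of the
  expectations.
\<close>

lemma sum_Pow_prod_if:
  fixes g h :: "'i \<Rightarrow> 'a::comm_semiring_1"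
  assumes "finite G"
  shows "(\<Sum>S\<in>Pow G. \<Prod>m\<in>G. if m \<in> S then h m else g m) = (\<Prod>m\<in>G. h m + g m)"
proof -
  have "(\<Prod>m\<in>G. if m \<in> S then h m else g m) = prod h S * prod g (G - S)" if "S \<subseteq> G" for S
  proof -
    have "G \<inter> {m. m \<in> S} = S" "G \<inter> - {m. m \<in> S} = G - S" using that by auto
    then show ?thesis using assms by (simp add: prod.If_cases)
  qed
  then show ?thesis
    using assms by (simp add: prod_add)
qed

text \<open>
  The rows of the matrix are represented by Riesz products. In the expansion of
  $\varepsilon_n \prod_m (1 + i b_m \varepsilon_m)$ every factor with $m \ne n$ has expectation
  $1$, and the factor $\varepsilon_n (1 + i b_n \varepsilon_n) = \varepsilon_n + i b_n$ has
  expectation $i b_n$.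
\<close>

lemma ex_bounded_function_with_rademacher_coefficients:
  fixes a :: "'i \<Rightarrow> real"
  assumes G: "finite G" and R: "0 < R" "(\<Sum>n\<in>G. (a n)\<^sup>2) \<le> R\<^sup>2"
  shows "\<exists>f. (\<forall>S. \<bar>f S\<bar> \<le> 2 * R) \<and>
    (\<forall>n\<in>G. (\<Sum>S\<in>Pow G. rademacher S n * f S) = 2 ^ card G * a n)"
proof -
  define b where "b n = a n / R" for n
  have a_eq: "a n = R * b n" for n using R(1) by (simp add: b_def)
  have "(\<Sum>n\<in>G. (b n)\<^sup>2) = (\<Sum>n\<in>G. (a n)\<^sup>2) / R\<^sup>2"
    by (simp add: b_def power_divide sum_divide_distrib)
  then have b: "(\<Sum>n\<in>G. (b n)\<^sup>2) \<le> 1"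
    using R by (simp add: divide_le_eq)
  define P where "P S = (\<Prod>m\<in>G. 1 + \<i> * complex_of_real (rademacher S m * b m))" for S
  have "\<bar>Im (P S)\<bar> \<le> 2" for S
  proof -
    have "(cmod (P S))\<^sup>2 = (\<Prod>m\<in>G. (cmod (1 + \<i> * complex_of_real (rademacher S m * b m)))\<^sup>2)"
      by (simp only: P_def prod_norm[symmetric] prod_power_distrib)
    also have "\<dots> = (\<Prod>m\<in>G. 1 + (b m)\<^sup>2)"
      by (intro prod.cong) (auto simp: cmod_power2 rademacher_def)
    also have "\<dots> \<le> (\<Prod>m\<in>G. exp ((b m)\<^sup>2))"
      by (intro prod_mono) (auto simp: exp_ge_add_one_self)
    also have "\<dots> = exp (\<Sum>m\<in>G. (b m)\<^sup>2)"
      using G by (simp add: exp_sum)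
    also have "\<dots> \<le> exp 1" using b by simp
    \<comment> \<open>The constant \<open>2\<close> in the bound for \<open>f\<close> comes from \<open>exp 1 \<le> 3 \<le> 4\<close>.\<close>
    also have "\<dots> \<le> 2\<^sup>2" using exp_le by simp
    finally have "cmod (P S) \<le> 2" by (rule power2_le_imp_le) simp
    then show ?thesis using abs_Im_le_cmod[of "P S"] by linarith
  qed
  then have "\<bar>R * Im (P S)\<bar> \<le> 2 * R" for S
    using R(1) by (simp add: abs_mult)
  moreover have "(\<Sum>S\<in>Pow G. rademacher S n * (R * Im (P S))) = 2 ^ card G * a n" if n: "n \<in> G" for n
  proof -
    \<comment> \<open>\<open>?h\<close> and \<open>?g\<close> are the factors for a positive and a negative sign, with the sign at \<open>n\<close> absorbed.\<close>
    let ?h = "\<lambda>m. 1 + \<i> * complex_of_real (b m)"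
    let ?g = "\<lambda>m. (if m = n then - 1 else 1) * (1 - \<i> * complex_of_real (b m))"
    have "rademacher S n * P S = (\<Prod>m\<in>G. if m \<in> S then ?h m else ?g m)" for S
    proof -
      have "complex_of_real (rademacher S n) = (\<Prod>m\<in>G. if m = n then rademacher S n else 1)"
        using n G by simp
      then have "rademacher S n * P S = (\<Prod>m\<in>G. (if m = n then rademacher S n else 1) *
          (1 + \<i> * complex_of_real (rademacher S m * b m)))"
        by (simp add: P_def prod.distrib)
      also have "\<dots> = (\<Prod>m\<in>G. if m \<in> S then ?h m else ?g m)"
        by (intro prod.cong) (auto simp: rademacher_def)
      finally show ?thesis .
    qed
    then have "(\<Sum>S\<in>Pow G. rademacher S n * P S) = (\<Prod>m\<in>G. ?h m + ?g m)"
      using sum_Pow_prod_if[OF G] by simp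
    also have "\<dots> = (?h n + ?g n) * (\<Prod>m\<in>G - {n}. ?h m + ?g m)"
      using G n by (rule prod.remove)
    also have "(\<Prod>m\<in>G - {n}. ?h m + ?g m) = (\<Prod>m\<in>G - {n}. 2)"
      by (intro prod.cong) auto
    also have "(?h n + ?g n) * (\<Prod>m\<in>G - {n}. 2) = 2 ^ Suc (card (G - {n})) * (\<i> * b n)"
      by simp
    also have "Suc (card (G - {n})) = card G" using G n by (rule card.remove[symmetric])
    finally have "Im (\<Sum>S\<in>Pow G. rademacher S n * P S) = Im (2 ^ card G * (\<i> * b n))" by simp
    also have "2 ^ card G * (\<i> * b n) = \<i> * complex_of_real (2 ^ card G * b n)" by simp
    also have "Im \<dots> = 2 ^ card G * b n" by (simp only: Im_i_times Re_complex_of_real)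
    finally have *: "(\<Sum>S\<in>Pow G. rademacher S n * Im (P S)) = 2 ^ card G * b n" by simp
    have "(\<Sum>S\<in>Pow G. rademacher S n * (R * Im (P S))) = R * (\<Sum>S\<in>Pow G. rademacher S n * Im (P S))"
      by (simp add: sum_distrib_left mult_ac)
    then show ?thesis using * by (simp add: a_eq mult_ac)
  qed
  ultimately show ?thesis by (intro exI[of _ "\<lambda>S. R * Im (P S)"]) blast
qed

section \<open>Separation of the two indices\<close>

text \<open>
  The analytic core. Writing the coefficients as averages
  $c_{kn} = \mathbf{E}\,\varepsilon_n f_k(\varepsilon)$ turns the double sum into an average of
  products of a vector $\sum_n \varepsilon_n e_n$, which depends on $n$ only, and a vector
  $\sum_k f_k(\varepsilon) x_k$, which depends on $k$ only. The vectors \<open>e n\<close> are arbitrary, so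
  that the lemma applies to an orthonormal basis as well as to its multiple by $i$.
\<close>

lemma ex_small_sums_of_square_bounded_combinations:
  fixes act :: "'a::real_normed_vector \<Rightarrow> 'x::banach \<Rightarrow> 'y::banach"
  assumes act: "bounded_bilinear act"
    and e: "\<And>z. unconditionally_convergent (\<lambda>n. act (e n) z)"
    and x: "unconditionally_convergent x" and R: "0 < R" and \<epsilon>: "0 < \<epsilon>"
  shows "\<exists>N. \<forall>F M c. finite F \<and> F \<subseteq> {N..} \<and> (\<forall>k\<in>F. (\<Sum>n<M. (c k n)\<^sup>2) \<le> R\<^sup>2) \<longrightarrow>
    norm (\<Sum>k\<in>F. act (\<Sum>n<M. c k n *\<^sub>R e n) (x k)) \<le> \<epsilon>"
proof -
  interpret act: bounded_bilinear act by (rule act)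
  \<comment> \<open>Over an infinite \<open>S\<close> the sum is \<open>0\<close>, so the family may be indexed by all sets.\<close>
  obtain C where C: "0 < C" "\<And>S z. norm (act (sum e S) z) \<le> C * norm z"
  proof (rule uniform_boundedness[of "\<lambda>S. act (sum e S)"])
    fix z
    have "small_tails (\<lambda>n. act (e n) z)"
      using e by (simp add: small_tails_iff_unconditionally_convergent)
    then obtain B where B: "\<And>S. finite S \<Longrightarrow> norm (\<Sum>n\<in>S. act (e n) z) \<le> B"
      using small_tails_bounded_sums by metis
    have "norm (act (sum e S) z) \<le> B" for S
    proof (cases "finite S")
      case True
      then show ?thesis using B by (simp add: act.sum_left)
    next
      case False
      then show ?thesis using B[of "{}"] by (simp add: act.zero_left)
    qed
    then show "\<exists>B. \<forall>S. norm (act (sum e S) z) \<le> B" by blast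
  qed (use act.bounded_linear_right in auto)
  have signed: "norm (act (\<Sum>n<M. rademacher S n *\<^sub>R e n) z) \<le> 2 * C * norm z" for M S z
  proof -
    have "(\<Sum>n<M. rademacher S n *\<^sub>R e n) = (\<Sum>n<M. if n \<in> S then e n else - e n)"
      by (intro sum.cong) (auto simp: rademacher_def)
    also have "\<dots> = sum e ({..<M} \<inter> S) - sum e ({..<M} - S)"
      by (simp add: sum.If_cases sum_negf Diff_eq)
    finally have "act (\<Sum>n<M. rademacher S n *\<^sub>R e n) z =
        act (sum e ({..<M} \<inter> S)) z - act (sum e ({..<M} - S)) z"
      by (simp add: act.diff_left)
    also have "norm \<dots> \<le> C * norm z + C * norm z"
      by (intro order_trans[OF norm_triangle_ineq4] add_mono C(2))
    finally show ?thesis by simp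
  qed
  \<comment> \<open>The factor \<open>8 * C * R\<close> is \<open>2 * C\<close> from the signed sums times \<open>2 * (2 * R)\<close> from
    scalars bounded by \<open>2 * R\<close>.\<close>
  define \<eta> where "\<eta> = \<epsilon> / (8 * C * R)"
  have "0 < \<eta>" using C(1) R \<epsilon> by (simp add: \<eta>_def)
  moreover have "small_tails x" using x by (simp add: small_tails_iff_unconditionally_convergent)
  ultimately obtain N where N: "\<And>F. finite F \<Longrightarrow> F \<subseteq> {N..} \<Longrightarrow> norm (sum x F) \<le> \<eta>"
    using small_tailsD by metis
  show ?thesis
  proof (intro exI[of _ N] allI impI; elim conjE)
    fix F M and c :: "nat \<Rightarrow> nat \<Rightarrow> real"
    assume F: "finite F" "F \<subseteq> {N..}" and "\<forall>k\<in>F. (\<Sum>n<M. (c k n)\<^sup>2) \<le> R\<^sup>2"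
    then have c: "\<And>k. k \<in> F \<Longrightarrow> (\<Sum>n<M. (c k n)\<^sup>2) \<le> R\<^sup>2" by blast
    have "\<exists>f. \<forall>k\<in>F. (\<forall>S. \<bar>f k S\<bar> \<le> 2 * R) \<and>
        (\<forall>n\<in>{..<M}. (\<Sum>S\<in>Pow {..<M}. rademacher S n * f k S) = 2 ^ card {..<M} * c k n)"
      using ex_bounded_function_with_rademacher_coefficients[OF finite_lessThan R c]
      by (intro bchoice ballI)
    then obtain f where f: "\<And>k S. k \<in> F \<Longrightarrow> \<bar>f k S\<bar> \<le> 2 * R"
      and f_coeff: "\<And>k n. k \<in> F \<Longrightarrow> n < M \<Longrightarrow>
        (\<Sum>S\<in>Pow {..<M}. rademacher S n * f k S) = 2 ^ M * c k n"
      by (metis card_lessThan lessThan_iff)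
    let ?v = "\<Sum>k\<in>F. act (\<Sum>n<M. c k n *\<^sub>R e n) (x k)"
    have "2 ^ M *\<^sub>R ?v = (\<Sum>k\<in>F. \<Sum>n<M. (2 ^ M * c k n) *\<^sub>R act (e n) (x k))"
      by (simp add: scaleR_sum_right act.sum_left act.scaleR_left)
    also have "\<dots> = (\<Sum>k\<in>F. \<Sum>n<M. \<Sum>S\<in>Pow {..<M}. (rademacher S n * f k S) *\<^sub>R act (e n) (x k))"
      by (intro sum.cong refl) (simp add: f_coeff[symmetric] scaleR_sum_left)
    also have "\<dots> = (\<Sum>k\<in>F. \<Sum>S\<in>Pow {..<M}. \<Sum>n<M. (rademacher S n * f k S) *\<^sub>R act (e n) (x k))"
      by (intro sum.cong refl sum.swap)
    also have "\<dots> = (\<Sum>S\<in>Pow {..<M}. \<Sum>k\<in>F. \<Sum>n<M. (rademacher S n * f k S) *\<^sub>R act (e n) (x k))"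
      by (rule sum.swap)
    also have "\<dots> = (\<Sum>S\<in>Pow {..<M}. act (\<Sum>n<M. rademacher S n *\<^sub>R e n) (\<Sum>k\<in>F. f k S *\<^sub>R x k))"
      by (simp add: act.sum_left act.sum_right act.scaleR_left act.scaleR_right scaleR_sum_right mult.commute)
    finally have "norm (2 ^ M *\<^sub>R ?v) \<le>
        (\<Sum>S\<in>Pow {..<M}. norm (act (\<Sum>n<M. rademacher S n *\<^sub>R e n) (\<Sum>k\<in>F. f k S *\<^sub>R x k)))"
      by (simp only: norm_sum)
    also have "\<dots> \<le> (\<Sum>S\<in>Pow {..<M}. \<epsilon>)"
    proof (rule sum_mono)
      fix S
      have "norm (sum x H) \<le> \<eta>" if "H \<subseteq> F" for H
        using F that by (intro N) (auto intro: finite_subset)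
      then have "norm (\<Sum>k\<in>F. f k S *\<^sub>R x k) \<le> 2 * (2 * R) * \<eta>"
        using F(1) R f by (intro norm_sum_scaleR_le) auto
      then have "2 * C * norm (\<Sum>k\<in>F. f k S *\<^sub>R x k) \<le> 2 * C * (2 * (2 * R) * \<eta>)"
        using C(1) by (intro mult_left_mono) auto
      also have "\<dots> = \<epsilon>" using C(1) R by (simp add: \<eta>_def)
      finally show "norm (act (\<Sum>n<M. rademacher S n *\<^sub>R e n) (\<Sum>k\<in>F. f k S *\<^sub>R x k)) \<le> \<epsilon>"
        using signed order_trans by blast
    qed
    also have "\<dots> = 2 ^ M * \<epsilon>" by (simp add: card_Pow)
    finally show "norm ?v \<le> \<epsilon>" by simp
  qed
qed

section \<open>Passage to bounded sequences in the Hilbert space\<close>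

text \<open>
  For a fixed finite set of indices the sum depends continuously on the finitely many vectors
  involved, so a bound for vectors in a dense set carries over to all vectors. Approximants of a
  vector of norm less than \<open>R\<close> eventually have norm less than \<open>R\<close> as well.
\<close>

lemma preserves_unconditional_convergence_if_small_sums_on_dense:
  fixes act :: "'a::real_normed_vector \<Rightarrow> 'x::banach \<Rightarrow> 'y::banach"
  assumes act: "bounded_bilinear act" and dense: "closure D = UNIV"
    and small: "\<And>x R \<epsilon>. unconditionally_convergent x \<Longrightarrow> 0 < R \<Longrightarrow> 0 < \<epsilon> \<Longrightarrow>
      \<exists>N. \<forall>F b. finite F \<and> F \<subseteq> {N..} \<and> (\<forall>k\<in>F. b k \<in> D \<and> norm (b k) \<le> R) \<longrightarrow>
        norm (\<Sum>k\<in>F. act (b k) (x k)) \<le> \<epsilon>"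
  shows "preserves_unconditional_convergence act"
  unfolding preserves_unconditional_convergence_def
proof (intro allI impI, elim conjE)
  interpret act: bounded_bilinear act by (rule act)
  fix x :: "nat \<Rightarrow> 'x" and a :: "nat \<Rightarrow> 'a"
  assume x: "unconditionally_convergent x" and a: "bounded (range a)"
  obtain R where R: "0 < R" "\<And>k. norm (a k) < R"
    using a unfolding bounded_pos_less by blast
  have "\<exists>b. (\<forall>j. b j \<in> D) \<and> b \<longlonglongrightarrow> a k" for k
    using dense by (metis UNIV_I closure_sequential)
  then obtain b where b: "\<And>k j. b k j \<in> D" "\<And>k. b k \<longlonglongrightarrow> a k"
    by metis
  have "small_tails (\<lambda>n. act (a n) (x n))"
    unfolding small_tails_def
  proof (intro allI impI)
    fix \<epsilon> :: real assume "0 < \<epsilon>"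
    then obtain N where N: "\<And>F b. finite F \<Longrightarrow> F \<subseteq> {N..} \<Longrightarrow> (\<forall>k\<in>F. b k \<in> D \<and> norm (b k) \<le> R) \<Longrightarrow>
        norm (\<Sum>k\<in>F. act (b k) (x k)) \<le> \<epsilon>"
      using small[OF x R(1)] by metis
    have "norm (\<Sum>k\<in>F. act (a k) (x k)) \<le> \<epsilon>" if F: "finite F" "F \<subseteq> {N..}" for F
    proof (rule tendsto_upperbound)
      show "(\<lambda>j. norm (\<Sum>k\<in>F. act (b k j) (x k))) \<longlonglongrightarrow> norm (\<Sum>k\<in>F. act (a k) (x k))"
        by (intro tendsto_intros act.tendsto b(2))
      have "\<forall>\<^sub>F j in sequentially. norm (b k j) < R" for k
        using tendsto_norm[OF b(2)] R(2) by (rule order_tendstoD(2))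
      then have "\<forall>\<^sub>F j in sequentially. \<forall>k\<in>F. norm (b k j) < R"
        using F(1) by (simp add: eventually_ball_finite)
      then show "\<forall>\<^sub>F j in sequentially. norm (\<Sum>k\<in>F. act (b k j) (x k)) \<le> \<epsilon>"
        by eventually_elim (use b(1) in \<open>intro N F, auto intro: less_imp_le\<close>)
    qed simp
    then show "\<exists>N. \<forall>F. finite F \<and> F \<subseteq> {N..} \<longrightarrow> norm (\<Sum>k\<in>F. act (a k) (x k)) \<le> \<epsilon>"
      by blast
  qed
  then show "unconditionally_convergent (\<lambda>n. act (a n) (x n))"
    by (simp add: small_tails_iff_unconditionally_convergent)
qed

text \<open>
  Continuity at the origin bounds the action on a small ball, and homogeneity rescales the bound.
  Stating this for both fields at once reduces complex actions to real ones.
\<close>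

lemma banach_action_imp_bounded_bilinear:
  fixes sA :: "'k::real_field \<Rightarrow> 'a::banach \<Rightarrow> 'a" and sX :: "'k \<Rightarrow> 'x::banach \<Rightarrow> 'x"
    and sY :: "'k \<Rightarrow> 'y::banach \<Rightarrow> 'y"
  assumes act: "banach_action sA sX sY act"
    and s: "\<And>r a. sA (of_real r) a = r *\<^sub>R a" "\<And>r x. sX (of_real r) x = r *\<^sub>R x"
      "\<And>r y. sY (of_real r) y = r *\<^sub>R y"
  shows "bounded_bilinear act"
proof -
  have lin: "Vector_Spaces.linear sA sY (\<lambda>a. act a x)" "Vector_Spaces.linear sX sY (act a)" for a x
    using act by (auto simp: banach_action_def)
  have add: "act (a + b) x = act a x + act b x" "act a (x + y) = act a x + act a y" for a b x y
    using lin by (auto simp: Vector_Spaces.linear_iff)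
  have scale: "act (r *\<^sub>R a) x = r *\<^sub>R act a x" "act a (r *\<^sub>R x) = r *\<^sub>R act a x" for r a x
    unfolding s[symmetric] using lin by (auto simp: Vector_Spaces.linear_iff)
  have "isCont (\<lambda>(a, x). act a x) (0, 0)"
    using act by (simp add: banach_action_def continuous_on_eq_continuous_at)
  moreover have "act 0 0 = 0" using scale(1)[of 0 0 0] by simp
  ultimately obtain d where d: "0 < d" "\<And>a x. norm (a, x) < d \<Longrightarrow> norm (act a x) < 1"
    unfolding continuous_at_eps_delta by (force simp: dist_norm dest: spec[of _ 1])
  let ?t = "d / 3"
  have unit: "norm (act a x) \<le> 9 / d\<^sup>2" if "norm a = 1" "norm x = 1" for a x
  proof -
    have "norm (?t *\<^sub>R a, ?t *\<^sub>R x) \<le> norm (?t *\<^sub>R a) + norm (?t *\<^sub>R x)"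
      by (rule norm_Pair_le)
    also have "\<dots> < d" using that d(1) by simp
    finally have "norm (act (?t *\<^sub>R a) (?t *\<^sub>R x)) < 1" by (rule d(2))
    then show ?thesis using d(1) by (simp add: scale field_simps power2_eq_square)
  qed
  show ?thesis
  proof
    show "\<exists>K. \<forall>a x. norm (act a x) \<le> norm a * norm x * K"
    proof (intro exI allI)
      fix a x
      show "norm (act a x) \<le> norm a * norm x * (9 / d\<^sup>2)"
      proof (cases "a = 0 \<or> x = 0")
        case True
        then have "act a x = 0" using scale(1)[of 0 0 x] scale(2)[of a 0 0] by auto
        then show ?thesis by simp
      next
        case False
        then have "norm (act (sgn a) (sgn x)) \<le> 9 / d\<^sup>2"
          by (intro unit) (simp_all add: norm_sgn)
        moreover have "act a x = (norm a * norm x) *\<^sub>R act (sgn a) (sgn x)"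
          using False by (simp add: sgn_div_norm scale field_simps)
        then have "norm (act a x) = norm a * norm x * norm (act (sgn a) (sgn x))"
          by (simp add: abs_mult)
        ultimately show ?thesis by (metis mult_left_mono mult_nonneg_nonneg norm_ge_zero)
      qed
    qed
  qed (use add scale in auto)
qed

text \<open>
  The vectors that agree with all but finitely many of their partial expansions form a subspace
  that contains every \<open>e m\<close>. Having the identity for all large \<open>M\<close> lets one \<open>M\<close> serve finitely
  many vectors.
\<close>

lemma eventually_eq_expansion_if_span:
  fixes s :: "'k::field \<Rightarrow> 'a::ab_group_add \<Rightarrow> 'a" and \<phi> :: "nat \<Rightarrow> 'a \<Rightarrow> 'k"
  assumes "vector_space s" and b: "b \<in> module.span s (range e)"
    and add: "\<And>n x y. \<phi> n (x + y) = \<phi> n x + \<phi> n y"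
    and scale: "\<And>n c x. \<phi> n (s c x) = c * \<phi> n x"
    and e: "\<And>m n. \<phi> m (e n) = (if m = n then 1 else 0)"
  shows "\<forall>\<^sub>F M in sequentially. b = (\<Sum>n<M. s (\<phi> n b) (e n))"
proof -
  interpret vector_space s by fact
  let ?S = "{b. \<forall>\<^sub>F M in sequentially. b = (\<Sum>n<M. s (\<phi> n b) (e n))}"
  have "\<phi> n 0 = 0" for n using add[of n 0 0] by (metis add.right_neutral add_left_cancel)
  then have "subspace ?S"
  proof (unfold subspace_def, safe)
    fix x y
    assume "\<forall>\<^sub>F M in sequentially. x = (\<Sum>n<M. s (\<phi> n x) (e n))"
      "\<forall>\<^sub>F M in sequentially. y = (\<Sum>n<M. s (\<phi> n y) (e n))"
    then show "\<forall>\<^sub>F M in sequentially. x + y = (\<Sum>n<M. s (\<phi> n (x + y)) (e n))"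
      by eventually_elim (simp add: add scale_left_distrib sum.distrib)
  next
    fix c x
    assume "\<forall>\<^sub>F M in sequentially. x = (\<Sum>n<M. s (\<phi> n x) (e n))"
    then show "\<forall>\<^sub>F M in sequentially. s c x = (\<Sum>n<M. s (\<phi> n (s c x)) (e n))"
    proof eventually_elim
      case (elim M)
      have "(\<Sum>n<M. s (\<phi> n (s c x)) (e n)) = s c (\<Sum>n<M. s (\<phi> n x) (e n))"
        by (simp add: scale scale_sum_right)
      then show ?case using elim by simp
    qed
  qed simp
  moreover have "e m \<in> ?S" for m
  proof -
    have "(\<Sum>n<M. s (\<phi> n (e m)) (e n)) = e m" if "Suc m \<le> M" for M
    proof -
      have "(\<Sum>n<M. s (\<phi> n (e m)) (e n)) = (\<Sum>n<M. if n = m then e n else 0)"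
        by (intro sum.cong) (auto simp: e)
      then show ?thesis using that by simp
    qed
    then have "\<forall>M\<ge>Suc m. e m = (\<Sum>n<M. s (\<phi> n (e m)) (e n))" by metis
    then show ?thesis unfolding mem_Collect_eq eventually_sequentially by (rule exI)
  qed
  ultimately have "span (range e) \<subseteq> ?S"
    by (intro span_minimal) auto
  then show ?thesis using b by blast
qed

section \<open>Real and complex actions\<close>

lemma real_action_preserves_unconditional_convergence:
  fixes act :: "'a::{real_inner, banach} \<Rightarrow> 'x::banach \<Rightarrow> 'y::banach"
  assumes action: "banach_action scaleR scaleR scaleR act"
    and basis: "orthonormal_basis scaleR inner e"
    and e: "\<And>z. unconditionally_convergent (\<lambda>n. act (e n) z)"
  shows "preserves_unconditional_convergence act"
proof -
  have act: "bounded_bilinear act"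
    using action by (rule banach_action_imp_bounded_bilinear) auto
  have expansion: "\<forall>\<^sub>F M in sequentially. b = (\<Sum>n<M. inner b (e n) *\<^sub>R e n)" if "b \<in> span (range e)" for b
  proof (rule eventually_eq_expansion_if_span[where s = scaleR and \<phi> = "\<lambda>n b. inner b (e n)"])
    show "vector_space ((*\<^sub>R) :: real \<Rightarrow> 'a \<Rightarrow> 'a)"
      by (rule real_vector.vector_space_axioms)
    show "b \<in> module.span (*\<^sub>R) (range e)"
      using that by (simp only: span_raw_def)
    show "inner (e n) (e m) = (if m = n then 1 else 0)" for m n
      using basis by (auto simp: orthonormal_basis_def)
  qed (simp_all add: inner_add_left)
  show ?thesis
  proof (rule preserves_unconditional_convergence_if_small_sums_on_dense[OF act])
    show "closure (span (range e)) = UNIV"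
      using basis by (simp add: orthonormal_basis_def span_raw_def)
    fix x :: "nat \<Rightarrow> 'x" and R \<epsilon> :: real
    assume x: "unconditionally_convergent x" and R: "0 < R" and \<epsilon>: "0 < \<epsilon>"
    obtain N where N: "\<forall>F M c. finite F \<and> F \<subseteq> {N..} \<and> (\<forall>k\<in>F. (\<Sum>n<M. (c k n)\<^sup>2) \<le> R\<^sup>2) \<longrightarrow>
        norm (\<Sum>k\<in>F. act (\<Sum>n<M. c k n *\<^sub>R e n) (x k)) \<le> \<epsilon>"
      using ex_small_sums_of_square_bounded_combinations[OF act e x R \<epsilon>] ..
    show "\<exists>N. \<forall>F b. finite F \<and> F \<subseteq> {N..} \<and> (\<forall>k\<in>F. b k \<in> span (range e) \<and> norm (b k) \<le> R) \<longrightarrow>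
        norm (\<Sum>k\<in>F. act (b k) (x k)) \<le> \<epsilon>"
    proof (intro exI[of _ "N"] allI impI; elim conjE)
      fix F and b :: "nat \<Rightarrow> 'a"
      assume F: "finite F" "F \<subseteq> {N..}" and "\<forall>k\<in>F. b k \<in> span (range e) \<and> norm (b k) \<le> R"
      then have b: "\<And>k. k \<in> F \<Longrightarrow> b k \<in> span (range e) \<and> norm (b k) \<le> R" by blast
      have "\<forall>\<^sub>F M in sequentially. \<forall>k\<in>F. b k = (\<Sum>n<M. inner (b k) (e n) *\<^sub>R e n)"
        using F(1) b expansion by (intro eventually_ball_finite) auto
      then obtain M where M: "\<And>k. k \<in> F \<Longrightarrow> b k = (\<Sum>n<M. inner (b k) (e n) *\<^sub>R e n)"
        unfolding eventually_sequentially by blast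
      have "(\<Sum>n<M. (inner (b k) (e n))\<^sup>2) \<le> R\<^sup>2" if k: "k \<in> F" for k
      proof -
        have "(norm (b k))\<^sup>2 = inner (b k) (b k)"
          by (rule power2_norm_eq_inner)
        also have "\<dots> = inner (b k) (\<Sum>n<M. inner (b k) (e n) *\<^sub>R e n)"
          using M[OF k] by (rule arg_cong)
        also have "\<dots> = (\<Sum>n<M. (inner (b k) (e n))\<^sup>2)"
          by (simp add: inner_sum_right power2_eq_square)
        finally show ?thesis using b[OF k] by (metis norm_ge_zero power_mono)
      qed
      then have "norm (\<Sum>k\<in>F. act (\<Sum>n<M. inner (b k) (e n) *\<^sub>R e n) (x k)) \<le> \<epsilon>"
        using F by (intro N[THEN spec, THEN spec, THEN spec, THEN mp]) auto
      also have "(\<Sum>k\<in>F. act (\<Sum>n<M. inner (b k) (e n) *\<^sub>R e n) (x k)) = (\<Sum>k\<in>F. act (b k) (x k))"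
        by (intro sum.cong refl) (simp only: M[symmetric])
      finally show "norm (\<Sum>k\<in>F. act (b k) (x k)) \<le> \<epsilon>" .
    qed
  qed
qed

lemma complex_action_preserves_unconditional_convergence:
  fixes act :: "'a::{complex_inner, banach} \<Rightarrow> 'x::{complex_normed_vector, banach} \<Rightarrow>
    'y::{complex_normed_vector, banach}"
  assumes action: "banach_action scaleC scaleC scaleC act"
    and basis: "orthonormal_basis scaleC cinner e"
    and e: "\<And>z. unconditionally_convergent (\<lambda>n. act (e n) z)"
  shows "preserves_unconditional_convergence act"
proof -
  let ?span = "module.span scaleC (range e)"
  let ?ie = "\<lambda>n. \<i> *\<^sub>C e n"
  have act: "bounded_bilinear act"
    using action by (rule banach_action_imp_bounded_bilinear) (simp_all add: scaleC_of_real)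
  interpret act: bounded_bilinear act by (rule act)
  \<comment> \<open>Complex bilinearity moves \<open>\<i>\<close> to the other argument, so the vectors \<open>\<i> *\<^sub>C e n\<close>
    satisfy the hypothesis on \<open>e\<close> too.\<close>
  have "act (\<i> *\<^sub>C a) z = act a (\<i> *\<^sub>C z)" for a z
    using action by (simp add: banach_action_def Vector_Spaces.linear_iff)
  then have ie: "unconditionally_convergent (\<lambda>n. act (?ie n) z)" for z
    using e by simp
  have expansion: "\<forall>\<^sub>F M in sequentially. b = (\<Sum>n<M. cinner b (e n) *\<^sub>C e n)" if "b \<in> ?span" for b
  proof (rule eventually_eq_expansion_if_span[where s = scaleC and \<phi> = "\<lambda>n b. cinner b (e n)"])
    show "cinner (e n) (e m) = (if m = n then 1 else 0)" for m n
      using basis by (auto simp: orthonormal_basis_def)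
  qed (use that in \<open>simp_all add: vector_space_scaleC cinner_add_left cinner_scaleC_left\<close>)
  show ?thesis
  proof (rule preserves_unconditional_convergence_if_small_sums_on_dense[OF act])
    show "closure ?span = UNIV"
      using basis by (simp add: orthonormal_basis_def)
    fix x :: "nat \<Rightarrow> 'x" and R \<epsilon> :: real
    assume x: "unconditionally_convergent x" and R: "0 < R" and "0 < \<epsilon>"
    then have "0 < \<epsilon> / 2" by simp
    obtain N1 where N1: "\<forall>F M c. finite F \<and> F \<subseteq> {N1..} \<and> (\<forall>k\<in>F. (\<Sum>n<M. (c k n)\<^sup>2) \<le> R\<^sup>2) \<longrightarrow>
        norm (\<Sum>k\<in>F. act (\<Sum>n<M. c k n *\<^sub>R e n) (x k)) \<le> \<epsilon> / 2"
      using ex_small_sums_of_square_bounded_combinations[OF act e x R \<open>0 < \<epsilon> / 2\<close>] ..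
    obtain N2 where N2: "\<forall>F M c. finite F \<and> F \<subseteq> {N2..} \<and> (\<forall>k\<in>F. (\<Sum>n<M. (c k n)\<^sup>2) \<le> R\<^sup>2) \<longrightarrow>
        norm (\<Sum>k\<in>F. act (\<Sum>n<M. c k n *\<^sub>R ?ie n) (x k)) \<le> \<epsilon> / 2"
      using ex_small_sums_of_square_bounded_combinations[OF act ie x R \<open>0 < \<epsilon> / 2\<close>] ..
    show "\<exists>N. \<forall>F b. finite F \<and> F \<subseteq> {N..} \<and> (\<forall>k\<in>F. b k \<in> ?span \<and> norm (b k) \<le> R) \<longrightarrow>
        norm (\<Sum>k\<in>F. act (b k) (x k)) \<le> \<epsilon>"
    proof (intro exI[of _ "max N1 N2"] allI impI; elim conjE)
      fix F and b :: "nat \<Rightarrow> 'a"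
      assume F: "finite F" "F \<subseteq> {max N1 N2..}" and "\<forall>k\<in>F. b k \<in> ?span \<and> norm (b k) \<le> R"
      then have b: "\<And>k. k \<in> F \<Longrightarrow> b k \<in> ?span \<and> norm (b k) \<le> R" by blast
      let ?c = "\<lambda>k n. cinner (b k) (e n)"
      have "\<forall>\<^sub>F M in sequentially. \<forall>k\<in>F. b k = (\<Sum>n<M. ?c k n *\<^sub>C e n)"
        using F(1) b expansion by (intro eventually_ball_finite) auto
      then obtain M where M: "\<And>k. k \<in> F \<Longrightarrow> b k = (\<Sum>n<M. ?c k n *\<^sub>C e n)"
        unfolding eventually_sequentially by blast
      have parseval: "(\<Sum>n<M. (cmod (?c k n))\<^sup>2) \<le> R\<^sup>2" if k: "k \<in> F" for k
      proof -
        have add: "Modules.additive (\<lambda>z. cinner z (b k))"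
          by standard (rule cinner_add_left)
        have "complex_of_real ((norm (b k))\<^sup>2) = cinner (b k) (b k)"
          by (rule cinner_self[symmetric])
        also have "\<dots> = cinner (\<Sum>n<M. ?c k n *\<^sub>C e n) (b k)"
          using M[OF k] by (rule arg_cong)
        also have "\<dots> = (\<Sum>n<M. ?c k n * cinner (e n) (b k))"
          by (simp add: additive.sum[OF add] cinner_scaleC_left)
        also have "\<dots> = (\<Sum>n<M. complex_of_real ((cmod (?c k n))\<^sup>2))"
          by (intro sum.cong refl) (metis cinner_commute complex_norm_square)
        finally have "(norm (b k))\<^sup>2 = (\<Sum>n<M. (cmod (?c k n))\<^sup>2)"
          by (metis of_real_eq_iff of_real_sum)
        then show ?thesis using b[OF k] by (metis norm_ge_zero power_mono)
      qed
      have "(\<Sum>n<M. (Re (?c k n))\<^sup>2) \<le> R\<^sup>2" "(\<Sum>n<M. (Im (?c k n))\<^sup>2) \<le> R\<^sup>2" if "k \<in> F" for k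
        by (rule order_trans[OF _ parseval[OF that]], rule sum_mono, simp add: cmod_power2)+
      then have "norm (\<Sum>k\<in>F. act (\<Sum>n<M. Re (?c k n) *\<^sub>R e n) (x k)) \<le> \<epsilon> / 2"
        "norm (\<Sum>k\<in>F. act (\<Sum>n<M. Im (?c k n) *\<^sub>R ?ie n) (x k)) \<le> \<epsilon> / 2"
        using F by (intro N1[THEN spec, THEN spec, THEN spec, THEN mp] N2[THEN spec, THEN spec, THEN spec, THEN mp]; auto)+
      then have "norm ((\<Sum>k\<in>F. act (\<Sum>n<M. Re (?c k n) *\<^sub>R e n) (x k)) +
          (\<Sum>k\<in>F. act (\<Sum>n<M. Im (?c k n) *\<^sub>R ?ie n) (x k))) \<le> \<epsilon>"
        by (intro norm_triangle_le) simp
      moreover have "b k = (\<Sum>n<M. Re (?c k n) *\<^sub>R e n) + (\<Sum>n<M. Im (?c k n) *\<^sub>R ?ie n)" if "k \<in> F" for k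
      proof -
        have re_im: "c *\<^sub>C z = Re c *\<^sub>R z + Im c *\<^sub>R (\<i> *\<^sub>C z)" for c and z :: 'a
        proof -
          have "Re c *\<^sub>R z + Im c *\<^sub>R (\<i> *\<^sub>C z) = (complex_of_real (Re c) + complex_of_real (Im c) * \<i>) *\<^sub>C z"
            by (simp only: scaleC_of_real[symmetric] scaleC_scaleC scaleC_add_left)
          then show ?thesis by (metis complex_eq mult.commute)
        qed
        have "b k = (\<Sum>n<M. ?c k n *\<^sub>C e n)" using M[OF that] .
        also have "\<dots> = (\<Sum>n<M. Re (?c k n) *\<^sub>R e n + Im (?c k n) *\<^sub>R ?ie n)"
          by (intro sum.cong refl re_im)
        also have "\<dots> = (\<Sum>n<M. Re (?c k n) *\<^sub>R e n) + (\<Sum>n<M. Im (?c k n) *\<^sub>R ?ie n)"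
          by (rule sum.distrib)
        finally show ?thesis .
      qed
      then have "(\<Sum>k\<in>F. act (b k) (x k)) = (\<Sum>k\<in>F. act (\<Sum>n<M. Re (?c k n) *\<^sub>R e n) (x k)) +
          (\<Sum>k\<in>F. act (\<Sum>n<M. Im (?c k n) *\<^sub>R ?ie n) (x k))"
        unfolding sum.distrib[symmetric] act.add_left[symmetric]
        by (intro sum.cong refl arg_cong2[where f = act])
      ultimately show "norm (\<Sum>k\<in>F. act (b k) (x k)) \<le> \<epsilon>" by simp
    qed
  qed
qed

theorem theorem1p4:
  fixes act\<^sub>R :: "'a::{real_inner, banach} \<Rightarrow> 'x::banach \<Rightarrow> 'y::banach"
    and e\<^sub>R :: "nat \<Rightarrow> 'a"
    and act\<^sub>C :: "'b::{complex_inner, banach} \<Rightarrow>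
        'u::{complex_normed_vector, banach} \<Rightarrow> 'v::{complex_normed_vector, banach}"
    and e\<^sub>C :: "nat \<Rightarrow> 'b"
  shows
    "(banach_action scaleR scaleR scaleR act\<^sub>R \<and>
      orthonormal_basis scaleR inner e\<^sub>R \<and>
      (\<forall>x. unconditionally_convergent (\<lambda>n. act\<^sub>R (e\<^sub>R n) x))
      \<longrightarrow> preserves_unconditional_convergence act\<^sub>R) \<and>
     (banach_action scaleC scaleC scaleC act\<^sub>C \<and>
      orthonormal_basis scaleC cinner e\<^sub>C \<and>
      (\<forall>x. unconditionally_convergent (\<lambda>n. act\<^sub>C (e\<^sub>C n) x))
      \<longrightarrow> preserves_unconditional_convergence act\<^sub>C)"
proof (intro conjI impI; elim conjE)
  assume "banach_action scaleR scaleR scaleR act\<^sub>R" "orthonormal_basis scaleR inner e\<^sub>R"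
    and "\<forall>x. unconditionally_convergent (\<lambda>n. act\<^sub>R (e\<^sub>R n) x)"
  then show "preserves_unconditional_convergence act\<^sub>R"
    using real_action_preserves_unconditional_convergence[of act\<^sub>R e\<^sub>R] by iprover
next
  assume "banach_action scaleC scaleC scaleC act\<^sub>C" "orthonormal_basis scaleC cinner e\<^sub>C"
    and "\<forall>x. unconditionally_convergent (\<lambda>n. act\<^sub>C (e\<^sub>C n) x)"
  then show "preserves_unconditional_convergence act\<^sub>C"
    using complex_action_preserves_unconditional_convergence[of act\<^sub>C e\<^sub>C] by iprover
qed

end
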